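(* Let $n\ge 1$ be an integer, let $m$ be a real number with $m\ge n$, and put $d=n/m$. Let $\mathcal U$ and $\mathcal W$ be nonempty finite sets and for each $(u,w)\in\mathcal U\times\mathcal W$ let $\alpha_{uw}\in\mathbb R$ and $\beta_{uw}\in[0,1]$; assume there is $(u,w)\in\mathcal U\times\mathcal W$ with $\beta_{uw}\in(0,1]$. Let $M^{uw}$ and $c^{uw}$ be the $n\times n$ matrix and the vector of $\mathbb R^n$ defined in the context. Then a solution $(\mu,x)\in\mathbb R\times\mathbb R^n$ of the system $$\mu+x_i=\min_{u\in\mathcal U}\max_{w\in\mathcal W}\left\{(M^{uw}x)_i+c^{uw}_i\right\},\qquad 1\le i\le n,$$ is given by $$\mu=\min_{u\in\mathcal U}\max_{w\in\mathcal W}\left\{\alpha_{uw}+\frac{\beta_{uw}}{d}\right\},\qquad x={}^t\left[0,\ \tfrac1d,\ \tfrac2d,\ \dots,\ \tfrac{n-1}{d}\right],\ \text{ i.e. } x_i=\frac{i-1}{d}.$$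
   Context: The setting is $n$ vehicles on a one-lane circular road of length $m$ (car density $d=n/m$). For $(u,w)\in\mathcal U\times\mathcal W$, the matrix $M^{uw}$ is defined by its action on $x\in\mathbb R^n$: $(M^{uw}x)_i=(1-\beta_{uw})x_i+\beta_{uw}x_{i+1}$ for $1\le i<n$, and $(M^{uw}x)_n=(1-\beta_{uw})x_n+\beta_{uw}x_1$. The vector $c^{uw}\in\mathbb R^n$ is given by $c^{uw}_i=\alpha_{uw}$ for $1\le i<n$ and $c^{uw}_n=\alpha_{uw}+n\beta_{uw}/d$. Here ${}^t[\cdot]$ denotes the transpose (column vector). *)

theory Defs
  imports "Jordan_Normal_Form.Matrix"
begin

text \<open>Vector and matrix indices start at 0: the vehicle numbered \<open>i + 1\<close> in the
  one-based convention has index \<open>i\<close>, and the last vehicle has index \<open>n - 1\<close>.\<close>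

text \<open>The matrix is specified by its action on vectors; the entries below realise that action,
  see \<open>traffic_mat_action\<close>. They are a sum of two conditionals because for \<open>n = 1\<close> the
  vehicle is its own successor and the two contributions fall on the same entry.\<close>

definition traffic_mat :: "nat \<Rightarrow> real \<Rightarrow> real mat" where
  "traffic_mat n b = mat n n (\<lambda>(i, j).
     (if j = i then 1 - b else 0) + (if j = (if i + 1 < n then i + 1 else 0) then b else 0))"

definition traffic_vec :: "nat \<Rightarrow> real \<Rightarrow> real \<Rightarrow> real \<Rightarrow> real vec" where
  "traffic_vec n d a b = vec n (\<lambda>i. if i + 1 < n then a else a + real n * b / d)"

definition is_solution ::
  "nat \<Rightarrow> real \<Rightarrow> 'u set \<Rightarrow> 'w set \<Rightarrow> ('u \<Rightarrow> 'w \<Rightarrow> real) \<Rightarrow> ('u \<Rightarrow> 'w \<Rightarrow> real) \<Rightarrow> real \<Rightarrow> real vec \<Rightarrow> bool"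
where
  "is_solution n d U W \<alpha> \<beta> \<mu> x \<longleftrightarrow>
     x \<in> carrier_vec n \<and>
     (\<forall>i<n. \<mu> + x $ i =
        (MIN u\<in>U. MAX w\<in>W.
           (traffic_mat n (\<beta> u w) *\<^sub>v x) $ i + traffic_vec n d (\<alpha> u w) (\<beta> u w) $ i))"

lemma traffic_mat_action:
  assumes x: "x \<in> carrier_vec n" and i: "i < n"
  shows "(traffic_mat n b *\<^sub>v x) $ i =
    (if i + 1 < n then (1 - b) * x $ i + b * x $ (i + 1) else (1 - b) * x $ i + b * x $ 0)"
proof -
  define s where "s = (if i + 1 < n then i + 1 else 0)"
  have s: "s < n" using i by (auto simp: s_def)
  have "(traffic_mat n b *\<^sub>v x) $ i =
      (\<Sum>j<n. ((if j = i then 1 - b else 0) + (if j = s then b else 0)) * x $ j)"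
    using x i by (auto simp: traffic_mat_def scalar_prod_def s_def lessThan_atLeast0 intro!: sum.cong)
  also have "\<dots> = (\<Sum>j<n. (if j = i then (1 - b) * x $ j else 0) + (if j = s then b * x $ j else 0))"
    by (rule sum.cong) (auto simp: algebra_simps)
  also have "\<dots> = (1 - b) * x $ i + b * x $ s"
    using i s by (simp add: sum.distrib)
  finally show ?thesis by (simp add: s_def)
qed

end

theory Submission imports Defs begin

text \<open>Equally spaced vehicles all advance alike: with \<open>x $ i = i / d\<close>, the gap to
  the vehicle ahead is \<open>1 / d\<close> everywhere, so each row under (u, w) equals \<alpha> u w
  + \<beta> u w / d plus \<open>x $ i\<close> (\<open>traffic_row\<close>). That last term depends
  on neither u nor w, hence comes out of the min-max, leaving \<mu>.\<close>

lemma traffic_row: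
  fixes d :: real
  assumes "i < n"
  shows "(traffic_mat n b *\<^sub>v vec n (\<lambda>i. real i / d)) $ i + traffic_vec n d a b $ i
    = (a + b / d) + real i / d"
proof (cases "i + 1 < n")
  case True
  then show ?thesis using assms
    by (simp add: traffic_mat_action traffic_vec_def algebra_simps add_divide_distrib diff_divide_distrib)
next
  case False
  \<comment> \<open>The last vehicle follows the one at position 0; the extra
    \<open>n * b / d\<close> in \<open>traffic_vec\<close> moves that leader to
    \<open>n / d\<close>, restoring the gap \<open>1 / d\<close>.\<close>
  then have "n = Suc i" using assms by simp
  then show ?thesis
    by (simp add: traffic_mat_action traffic_vec_def algebra_simps add_divide_distrib diff_divide_distrib)
qed

theorem theorem6:
  fixes n :: nat and m d :: real
    and U :: "'u set" and W :: "'w set"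
    and \<alpha> \<beta> :: "'u \<Rightarrow> 'w \<Rightarrow> real"
  assumes "n \<ge> 1" and "m \<ge> real n" and "d = real n / m"
    and "finite U" and "U \<noteq> {}" and "finite W" and "W \<noteq> {}"
    and "\<And>u w. u \<in> U \<Longrightarrow> w \<in> W \<Longrightarrow> \<beta> u w \<in> {0..1}"
    and "\<exists>u\<in>U. \<exists>w\<in>W. \<beta> u w \<in> {0<..1}"
  shows "is_solution n d U W \<alpha> \<beta>
    (MIN u\<in>U. MAX w\<in>W. \<alpha> u w + \<beta> u w / d)
    (vec n (\<lambda>i. real i / d))"
  unfolding is_solution_def
proof (intro conjI allI impI)
  fix i assume i: "i < n"
  show "(MIN u\<in>U. MAX w\<in>W. \<alpha> u w + \<beta> u w / d) + vec n (\<lambda>i. real i / d) $ i =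
    (MIN u\<in>U. MAX w\<in>W. (traffic_mat n (\<beta> u w) *\<^sub>v vec n (\<lambda>i. real i / d)) $ i
       + traffic_vec n d (\<alpha> u w) (\<beta> u w) $ i)"
    \<comment> \<open>Finiteness and nonemptiness of \<open>U\<close> and \<open>W\<close> let the
      constant \<open>real i / d\<close> pass out of \<open>Max\<close>, then out of
      \<open>Min\<close>.\<close>
    using assms(4-7)
    by (simp only: traffic_row[OF i] Max_add_commute Min_add_commute index_vec[OF i] simp_thms)
qed simp

end
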